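(* Let $H_1,H_2$ be complex Hilbert spaces and let $$\mathcal T=\begin{pmatrix}A&B\\C&D\end{pmatrix},\qquad\operatorname{dom}(\mathcal T)=(\operatorname{dom}(A)\cap\operatorname{dom}(C))\oplus(\operatorname{dom}(B)\cap\operatorname{dom}(D)),$$ be a block operator matrix in $H_1\oplus H_2$. For $(x,y)^t\in\operatorname{dom}(\mathcal T)$ let $$\mathcal T_{x,y}=\begin{pmatrix}\langle Ax,x\rangle&\langle By,x\rangle\\ \langle Cx,y\rangle&\langle Dy,y\rangle\end{pmatrix}\in\mathbb C^{2\times2}.$$ (i) The quadratic numerical range satisfies $$W^2(\mathcal T):=\bigcup_{(x,y)^t\in\operatorname{dom}(\mathcal T),\ \|x\|=\|y\|=1}\sigma(\mathcal T_{x,y})\subseteq\bigcap_{a,d\in\mathbb C}W(\operatorname{diag}(a,d)\mathcal T,\operatorname{diag}(a,d)).$$ (ii) For $\Lambda\subseteq\mathbb C^2$ let $$\Omega\subseteq\mathbb C\setminus\bigcap_{(a,d)^t\in\Lambda}W(\operatorname{diag}(a,d)\mathcal T,\operatorname{diag}(a,d))$$ be a connected set with $\Omega\cap\rho(\mathcal T)\ne\emptyset$. Then $\Omega\subseteq\rho(\mathcal T)$ and, for any $\lambda\in\Omega$, $$\|(\mathcal T-\lambda)^{-1}\|\le\inf_{(a,d)^t\in\Lambda}\frac{\max\{|a|,|d|\}}{\operatorname{dist}\big(0,\operatorname{conv}\{a,d\}\big)\operatorname{dist}\big(\lambda,W(\operatorname{diag}(a,d)\mathcal T,\operatorname{dia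g}(a,d))\big)}.$$
   Context: $A$ is a linear operator in $H_1$, $D$ a linear operator in $H_2$, $B$ a linear operator from $H_2$ to $H_1$, $C$ a linear operator from $H_1$ to $H_2$ (all possibly unbounded). $\operatorname{diag}(a,d)$ denotes the bounded operator $(x,y)^t\mapsto(ax,dy)^t$ on $H_1\oplus H_2$. For linear operators $S,R$ with $\operatorname{dom}(S)\subseteq\operatorname{dom}(R)$, $W(S,R)=\{\lambda\in\mathbb C:0\in\overline{W(S-\lambda R)}\}$, where $W(Q)=\{\langle Qx,x\rangle:x\in\operatorname{dom}(Q),\|x\|=1\}$ is the numerical range. $\operatorname{conv}$ denotes the convex hull. A quotient in the infimum with zero denominator is read as $+\infty$. *)

theory Defs
  imports "HOL-Analysis.Analysis" "Jordan_Normal_Form.Spectral_Radius"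
begin

section \<open>Complex Hilbert spaces\<close>

class complex_vector = real_vector +
  fixes scaleC :: "complex \<Rightarrow> 'a \<Rightarrow> 'a"  (infixr \<open>*\<^sub>C\<close> 75)
  assumes scaleC_add_right: "c *\<^sub>C (x + y) = c *\<^sub>C x + c *\<^sub>C y"
    and scaleC_add_left: "(b + c) *\<^sub>C x = b *\<^sub>C x + c *\<^sub>C x"
    and scaleC_scaleC: "b *\<^sub>C c *\<^sub>C x = (b * c) *\<^sub>C x"
    and scaleC_one: "1 *\<^sub>C x = x"
    and scaleR_scaleC: "r *\<^sub>R x = complex_of_real r *\<^sub>C x"

global_interpretation complex_vector:
  vector_space "scaleC :: complex \<Rightarrow> 'a \<Rightarrow> 'a::complex_vector"
  by unfold_locales
    (simp_all add: scaleC_add_right scaleC_add_left scaleC_scaleC scaleC_one)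

text \<open>
  The complex inner product is linear in its first argument. The real inner product of the
  superclass is required to be its real part; hence the positivity of \<open>cinner\<close> and the identity
  \<open>norm x ^ 2 = cinner x x\<close> are inherited from the class \<open>real_inner\<close>.
\<close>

class complex_inner = complex_vector + real_inner +
  fixes cinner :: "'a \<Rightarrow> 'a \<Rightarrow> complex"
  assumes cinner_commute: "cinner x y = cnj (cinner y x)"
    and cinner_add_left: "cinner (x + y) z = cinner x z + cinner y z"
    and cinner_scaleC_left: "cinner (c *\<^sub>C x) y = c * cinner x y"
    and inner_eq_Re_cinner: "inner x y = Re (cinner x y)"

class complex_hilbert = complex_inner + complete_space

lemma cinner_self:
  fixes x :: "'a::complex_inner"
  shows "cinner x x = complex_of_real ((norm x)\<^sup>2)"
proof -
  have "Im (cinner x x) = 0"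
    using arg_cong[OF cinner_commute[of x x], of Im] by simp
  moreover have "Re (cinner x x) = (norm x)\<^sup>2"
    using inner_eq_Re_cinner[of x x] by (simp add: power2_norm_eq_inner)
  ultimately show ?thesis
    by (simp add: complex_eq_iff)
qed

instantiation complex :: complex_hilbert
begin

definition scaleC_complex :: "complex \<Rightarrow> complex \<Rightarrow> complex"
  where "scaleC_complex c z = c * z"

definition cinner_complex :: "complex \<Rightarrow> complex \<Rightarrow> complex"
  where "cinner_complex z w = z * cnj w"

instance
  by intro_classes
    (simp_all add: scaleC_complex_def cinner_complex_def inner_complex_def
      algebra_simps scaleR_conv_of_real)

end

text \<open>
  The orthogonal sum of two Hilbert spaces is the product type, whose library norm is
  \<open>norm (x, y) = sqrt (norm x ^ 2 + norm y ^ 2)\<close>.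
\<close>

instantiation prod :: (complex_vector, complex_vector) complex_vector
begin

definition scaleC_prod :: "complex \<Rightarrow> 'a \<times> 'b \<Rightarrow> 'a \<times> 'b"
  where "scaleC_prod c z = (c *\<^sub>C fst z, c *\<^sub>C snd z)"

instance
  by intro_classes
    (simp_all add: scaleC_prod_def scaleC_add_right scaleC_add_left scaleC_scaleC scaleC_one
      scaleR_scaleC prod_eq_iff)

end

instantiation prod :: (complex_inner, complex_inner) complex_inner
begin

definition cinner_prod :: "'a \<times> 'b \<Rightarrow> 'a \<times> 'b \<Rightarrow> complex"
  where "cinner_prod z w = cinner (fst z) (fst w) + cinner (snd z) (snd w)"

instance
proof
  fix x y z :: "'a \<times> 'b" and c :: complex
  show "cinner x y = cnj (cinner y x)"
    using cinner_commute[of "fst x" "fst y"] cinner_commute[of "snd x" "snd y"]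
    by (simp add: cinner_prod_def)
qed (simp_all add: cinner_prod_def scaleC_prod_def cinner_add_left cinner_scaleC_left
    inner_prod_def inner_eq_Re_cinner algebra_simps)

end

instance prod :: (complex_hilbert, complex_hilbert) complex_hilbert ..


section \<open>Unbounded linear operators\<close>

text \<open>Only the values of \<open>op_app T\<close> on \<open>op_dom T\<close> are meaningful.\<close>

record ('a, 'b) operator =
  op_dom :: "'a set"
  op_app :: "'a \<Rightarrow> 'b"

definition linear_operator :: "('a::complex_vector, 'b::complex_vector) operator \<Rightarrow> bool"
  where "linear_operator T \<longleftrightarrow>
    complex_vector.subspace (op_dom T) \<and>
    (\<forall>x\<in>op_dom T. \<forall>y\<in>op_dom T. op_app T (x + y) = op_app T x + op_app T y) \<and>
    (\<forall>c. \<forall>x\<in>op_dom T. op_app T (c *\<^sub>C x) = c *\<^sub>C op_app T x)"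

definition op_id :: "('a, 'a) operator"
  where "op_id = \<lparr>op_dom = UNIV, op_app = (\<lambda>x. x)\<rparr>"

definition op_minus ::
    "('a, 'b::complex_vector) operator \<Rightarrow> ('a, 'b) operator \<Rightarrow> ('a, 'b) operator"
  where "op_minus S R =
    \<lparr>op_dom = op_dom S \<inter> op_dom R, op_app = (\<lambda>x. op_app S x - op_app R x)\<rparr>"

definition op_scale :: "complex \<Rightarrow> ('a, 'b::complex_vector) operator \<Rightarrow> ('a, 'b) operator"
  where "op_scale c R = \<lparr>op_dom = op_dom R, op_app = (\<lambda>x. c *\<^sub>C op_app R x)\<rparr>"

definition op_comp :: "('b, 'c) operator \<Rightarrow> ('a, 'b) operator \<Rightarrow> ('a, 'c) operator"
  where "op_comp S T =
    \<lparr>op_dom = {x \<in> op_dom T. op_app T x \<in> op_dom S}, op_app = (\<lambda>x. op_app S (op_app T x))\<rparr>"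

definition op_diag ::
    "complex \<Rightarrow> complex \<Rightarrow> ('a::complex_vector \<times> 'b::complex_vector, 'a \<times> 'b) operator"
  where "op_diag a d = \<lparr>op_dom = UNIV, op_app = (\<lambda>(x, y). (a *\<^sub>C x, d *\<^sub>C y))\<rparr>"


section \<open>Resolvent set\<close>

text \<open>
  The map \<open>resolvent T z\<close> is the inverse of \<open>T - z\<close>; it is meaningful only if \<open>T - z\<close> maps its
  domain bijectively onto the whole space. Real linearity in \<open>bounded_linear\<close> is no loss, since
  the inverse of a complex linear bijection is complex linear.
\<close>

definition resolvent ::
    "('a::complex_hilbert, 'a) operator \<Rightarrow> complex \<Rightarrow> 'a \<Rightarrow> 'a"
  where "resolvent T z =
    (let Q = op_minus T (op_scale z op_id) in inv_into (op_dom Q) (op_app Q))"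

definition resolvent_set :: "('a::complex_hilbert, 'a) operator \<Rightarrow> complex set"
  where "resolvent_set T =
    {z. let Q = op_minus T (op_scale z op_id) in
      bij_betw (op_app Q) (op_dom Q) UNIV \<and> bounded_linear (resolvent T z)}"


section \<open>Numerical ranges\<close>

definition num_range :: "('a::complex_inner, 'a) operator \<Rightarrow> complex set"
  where "num_range Q = {cinner (op_app Q x) x |x. x \<in> op_dom Q \<and> norm x = 1}"

text \<open>Meant for \<open>op_dom S \<subseteq> op_dom R\<close>, in which case \<open>S - z R\<close> has the domain of \<open>S\<close>.\<close>

definition pencil_range ::
    "('a::complex_inner, 'a) operator \<Rightarrow> ('a, 'a) operator \<Rightarrow> complex set"
  where "pencil_range S R = {z. 0 \<in> closure (num_range (op_minus S (op_scale z R)))}"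


section \<open>Block operator matrices\<close>

definition block_op ::
    "('a::complex_vector, 'a) operator \<Rightarrow> ('b::complex_vector, 'a) operator \<Rightarrow>
     ('a, 'b) operator \<Rightarrow> ('b, 'b) operator \<Rightarrow> ('a \<times> 'b, 'a \<times> 'b) operator"
  where "block_op A B C D =
    \<lparr>op_dom = (op_dom A \<inter> op_dom C) \<times> (op_dom B \<inter> op_dom D),
     op_app = (\<lambda>(x, y). (op_app A x + op_app B y, op_app C x + op_app D y))\<rparr>"

definition block_mat ::
    "('a::complex_inner, 'a) operator \<Rightarrow> ('b::complex_inner, 'a) operator \<Rightarrow>
     ('a, 'b) operator \<Rightarrow> ('b, 'b) operator \<Rightarrow> 'a \<Rightarrow> 'b \<Rightarrow> complex mat"
  where "block_mat A B C D x y = mat_of_rows_list 2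
    [[cinner (op_app A x) x, cinner (op_app B y) x],
     [cinner (op_app C x) y, cinner (op_app D y) y]]"

definition quadratic_num_range ::
    "('a::complex_inner, 'a) operator \<Rightarrow> ('b::complex_inner, 'a) operator \<Rightarrow>
     ('a, 'b) operator \<Rightarrow> ('b, 'b) operator \<Rightarrow> complex set"
  where "quadratic_num_range A B C D =
    (\<Union>(x, y)\<in>{(x, y). (x, y) \<in> op_dom (block_op A B C D) \<and> norm x = 1 \<and> norm y = 1}.
      spectrum (block_mat A B C D x y))"


section \<open>Extended-valued quotients and distances\<close>

text \<open>
  The distance to the empty set is \<open>\<infinity>\<close> here, whereas \<open>infdist x {} = 0\<close>.
\<close>

definition set_dist :: "complex \<Rightarrow> complex set \<Rightarrow> ereal"
  where "set_dist z M = (INF w\<in>M. ereal (dist z w))"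

text \<open>
  A vanishing denominator gives \<open>\<infinity>\<close>, also for \<open>0 / 0\<close>; in \<open>ereal\<close> itself \<open>0 / 0 = 0\<close>.
\<close>

definition ext_quot :: "ereal \<Rightarrow> ereal \<Rightarrow> ereal"
  where "ext_quot r s = (if s = 0 then \<infinity> else r / s)"

end

theory Submission
  imports Defs
begin

text \<open>
  A point \<open>z\<close> outside the range of the pencil \<open>(diag(a, d) T, diag(a, d))\<close> is of regular type:
  \<open>T - z\<close> is bounded below, because \<open>diag(a, d)\<close> is bounded. On points of regular type
  membership in the resolvent set is both an open and a closed condition, so it spreads over
  connected sets. For a unit vector \<open>v\<close> with \<open>p = \<langle>diag(a, d) v, v\<rangle> \<noteq> 0\<close> the number
  \<open>\<mu> = \<langle>diag(a, d) T v, v\<rangle> / p\<close> lies in the range of the pencil and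
  \<open>\<langle>diag(a, d) (T - z) v, v\<rangle> = (\<mu> - z) p\<close>; as \<open>p\<close> lies in \<open>conv {a, d}\<close>, this yields the
  resolvent estimate.
\<close>

section \<open>Complex inner products\<close>

text \<open>The class axioms tie the norm to real scalars only; for complex ones it is recovered
  from \<open>cinner_self\<close>.\<close>

lemma norm_scaleC: "norm (c *\<^sub>C x) = cmod c * norm x" for x :: "'a::complex_inner"
proof -
  have "complex_of_real ((norm (c *\<^sub>C x))\<^sup>2) = cinner (c *\<^sub>C x) (c *\<^sub>C x)"
    by (simp only: cinner_self)
  also have "\<dots> = c * cnj (cinner (c *\<^sub>C x) x)"
    by (simp only: cinner_scaleC_left cinner_commute[of x "c *\<^sub>C x"])
  also have "\<dots> = (c * cnj c) * complex_of_real ((norm x)\<^sup>2)"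
    by (simp add: cinner_scaleC_left cinner_self)
  also have "\<dots> = complex_of_real ((cmod c * norm x)\<^sup>2)"
    by (simp only: complex_norm_square[symmetric] power_mult_distrib of_real_mult)
  finally have "(norm (c *\<^sub>C x))\<^sup>2 = (cmod c * norm x)\<^sup>2"
    by (simp only: of_real_eq_iff)
  then show ?thesis
    by (simp add: power2_eq_iff_nonneg)
qed

lemma cinner_scaleC_right: "cinner x (c *\<^sub>C y) = cnj c * cinner x y"
  using cinner_commute[of x "c *\<^sub>C y"] cinner_commute[of x y] by (simp add: cinner_scaleC_left)

lemma cinner_diff_left: "cinner (x - y) z = cinner x z - cinner y z"
  using cinner_add_left[of "x - y" y z] by simp

lemma Cauchy_Schwarz_cinner: "cmod (cinner x y) \<le> norm x * norm y"
proof (cases "cinner x y = 0")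
  case False
  \<comment> \<open>This unimodular factor rotates \<open>cinner x y\<close> onto the positive real
    axis, where the real Cauchy-Schwarz inequality applies.\<close>
  define u where "u = cnj (sgn (cinner x y))"
  have u: "cmod u = 1"
    using False by (simp add: u_def norm_sgn)
  have "u * cinner x y = complex_of_real (cmod (cinner x y))"
    using False complex_norm_square[of "cinner x y"]
    by (simp add: u_def sgn_eq field_simps power2_eq_square)
  then have "cmod (cinner x y) = inner (u *\<^sub>C x) y"
    by (simp add: inner_eq_Re_cinner cinner_scaleC_left)
  also have "\<dots> \<le> norm (u *\<^sub>C x) * norm y"
    by (rule norm_cauchy_schwarz)
  finally show ?thesis
    by (simp add: norm_scaleC u)
qed simp


section \<open>Points of regular type and the resolvent set\<close>

text \<open>No sign is imposed on \<open>m\<close>, so that the constant can be lowered freely; for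
  \<open>m \<le> 0\<close> the condition is vacuous, and positivity is demanded where it
  matters.\<close>

definition bounded_below ::
    "('a::complex_inner, 'a) operator \<Rightarrow> complex \<Rightarrow> real \<Rightarrow> bool"
  where "bounded_below T z m \<longleftrightarrow>
    (\<forall>x\<in>op_dom T. m * norm x \<le> norm (op_app T x - z *\<^sub>C x))"

lemma bounded_belowD:
  "bounded_below T z m \<Longrightarrow> x \<in> op_dom T \<Longrightarrow> m * norm x \<le> norm (op_app T x - z *\<^sub>C x)"
  by (simp add: bounded_below_def)

text \<open>Homogeneity reduces the bound to unit vectors, the only vectors that a numerical range
  sees.\<close>

lemma bounded_below_if_unit:
  assumes T: "linear_operator T"
    and m: "\<And>x. x \<in> op_dom T \<Longrightarrow> norm x = 1 \<Longrightarrow> m \<le> norm (op_app T x - z *\<^sub>C x)"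
  shows "bounded_below T z m"
  unfolding bounded_below_def
proof
  fix x assume x: "x \<in> op_dom T"
  show "m * norm x \<le> norm (op_app T x - z *\<^sub>C x)"
  proof (cases "x = 0")
    case False
    define c where "c = complex_of_real (inverse (norm x))"
    have c: "cmod c = inverse (norm x)"
      by (simp add: c_def norm_inverse)
    have "c *\<^sub>C x \<in> op_dom T" "op_app T (c *\<^sub>C x) = c *\<^sub>C op_app T x"
      using T x by (auto simp: linear_operator_def complex_vector.subspace_scale)
    moreover have "norm (c *\<^sub>C x) = 1"
      using False by (simp add: norm_scaleC c)
    ultimately have "m \<le> norm (c *\<^sub>C op_app T x - z *\<^sub>C c *\<^sub>C x)"
      using m[of "c *\<^sub>C x"] by simp
    moreover have "c *\<^sub>C op_app T x - z *\<^sub>C c *\<^sub>C x = c *\<^sub>C (op_app T x - z *\<^sub>C x)"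
      by (simp add: complex_vector.scale_right_diff_distrib scaleC_scaleC mult.commute)
    ultimately have "m \<le> inverse (norm x) * norm (op_app T x - z *\<^sub>C x)"
      by (simp only: norm_scaleC c)
    then show ?thesis
      using False by (simp add: field_simps)
  qed simp
qed

text \<open>The triangle inequality; its explicit loss \<open>dist z w\<close> determines the radii
  in the connectedness argument.\<close>

lemma bounded_below_perturb:
  assumes "bounded_below T z m"
  shows "bounded_below T w (m - dist z w)"
  unfolding bounded_below_def
proof
  fix x assume "x \<in> op_dom T"
  then have "m * norm x \<le> norm (op_app T x - z *\<^sub>C x)"
    by (rule bounded_belowD[OF assms])
  also have "\<dots> = norm ((op_app T x - w *\<^sub>C x) - (z - w) *\<^sub>C x)"
    by (simp add: complex_vector.scale_left_diff_distrib)
  also have "\<dots> \<le> norm (op_app T x - w *\<^sub>C x) + dist z w * norm x"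
    using norm_triangle_ineq4[of "op_app T x - w *\<^sub>C x" "(z - w) *\<^sub>C x"]
    by (simp add: norm_scaleC dist_norm)
  finally show "(m - dist z w) * norm x \<le> norm (op_app T x - w *\<^sub>C x)"
    by (simp add: algebra_simps)
qed

section \<open>The resolvent as a bounded inverse\<close>

lemma resolvent_eq:
  "resolvent T z = inv_into (op_dom T) (\<lambda>x. op_app T x - z *\<^sub>C x)"
  by (simp add: resolvent_def op_minus_def op_scale_def op_id_def)

lemma mem_resolvent_set_iff:
  "z \<in> resolvent_set T \<longleftrightarrow>
    bij_betw (\<lambda>x. op_app T x - z *\<^sub>C x) (op_dom T) UNIV \<and> bounded_linear (resolvent T z)"
  by (simp add: resolvent_set_def op_minus_def op_scale_def op_id_def)

lemma resolvent_props:
  assumes "bij_betw (\<lambda>x. op_app T x - z *\<^sub>C x) (op_dom T) UNIV"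
  shows resolvent_in_dom: "resolvent T z y \<in> op_dom T"
    and resolvent_right: "op_app T (resolvent T z y) - z *\<^sub>C resolvent T z y = y"
    and resolvent_left: "x \<in> op_dom T \<Longrightarrow> resolvent T z (op_app T x - z *\<^sub>C x) = x"
proof -
  let ?f = "\<lambda>x. op_app T x - z *\<^sub>C x"
  have y: "y \<in> ?f ` op_dom T"
    using assms by (simp add: bij_betw_def)
  show "resolvent T z y \<in> op_dom T"
    unfolding resolvent_eq by (rule inv_into_into[OF y])
  show "op_app T (resolvent T z y) - z *\<^sub>C resolvent T z y = y"
    unfolding resolvent_eq by (rule f_inv_into_f[OF y])
  show "resolvent T z (op_app T x - z *\<^sub>C x) = x" if "x \<in> op_dom T"
    unfolding resolvent_eq
    using inv_into_f_f[OF bij_betw_imp_inj_on[OF assms] that] .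
qed

lemma resolvent_set_bounded_below:
  assumes "z \<in> resolvent_set T"
  obtains m where "m > 0" "bounded_below T z m"
proof -
  have bij: "bij_betw (\<lambda>x. op_app T x - z *\<^sub>C x) (op_dom T) UNIV"
    and bl: "bounded_linear (resolvent T z)"
    using assms by (auto simp: mem_resolvent_set_iff)
  obtain K where K: "K > 0" "\<And>y. norm (resolvent T z y) \<le> norm y * K"
    using bounded_linear.pos_bounded[OF bl] by blast
  have "bounded_below T z (inverse K)"
    unfolding bounded_below_def
  proof
    fix x assume "x \<in> op_dom T"
    then show "inverse K * norm x \<le> norm (op_app T x - z *\<^sub>C x)"
      using K(2)[of "op_app T x - z *\<^sub>C x"] resolvent_left[OF bij] K(1)
      by (simp add: field_simps)
  qed
  then show thesis
    using that[of "inverse K"] K(1) by simp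
qed

text \<open>The lower bound \<open>m\<close> turns into a norm bound for the inverse. Linearity of
  the inverse follows from injectivity: both sides are preimages of the same vector.\<close>

lemma resolvent_setI:
  assumes T: "linear_operator T"
    and bij: "bij_betw (\<lambda>x. op_app T x - z *\<^sub>C x) (op_dom T) UNIV"
    and m: "m > 0" "bounded_below T z m"
  shows "z \<in> resolvent_set T"
proof -
  let ?R = "resolvent T z"
  note R = resolvent_in_dom[OF bij] resolvent_right[OF bij] resolvent_left[OF bij]
  have sub: "complex_vector.subspace (op_dom T)"
    and add: "\<And>x y. x \<in> op_dom T \<Longrightarrow> y \<in> op_dom T \<Longrightarrow> op_app T (x + y) = op_app T x + op_app T y"
    and scale: "\<And>c x. x \<in> op_dom T \<Longrightarrow> op_app T (c *\<^sub>C x) = c *\<^sub>C op_app T x"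
    using T by (auto simp: linear_operator_def)
  have "bounded_linear ?R"
  proof (rule bounded_linear_intro)
    fix x y
    have "?R x + ?R y \<in> op_dom T"
      by (simp add: complex_vector.subspace_add sub R(1))
    moreover have "op_app T (?R x + ?R y) - z *\<^sub>C (?R x + ?R y) = x + y"
    proof -
      have "op_app T (?R x + ?R y) - z *\<^sub>C (?R x + ?R y)
          = (op_app T (?R x) - z *\<^sub>C ?R x) + (op_app T (?R y) - z *\<^sub>C ?R y)"
        by (simp add: add R(1) scaleC_add_right)
      then show ?thesis by (simp only: R(2))
    qed
    ultimately show "?R (x + y) = ?R x + ?R y"
      using R(3)[of "?R x + ?R y"] by simp
  next
    fix r x
    have "r *\<^sub>R ?R x \<in> op_dom T"
      by (simp add: scaleR_scaleC complex_vector.subspace_scale sub R(1))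
    moreover have "op_app T (r *\<^sub>R ?R x) - z *\<^sub>C (r *\<^sub>R ?R x) = r *\<^sub>R x"
    proof -
      have "op_app T (r *\<^sub>R ?R x) - z *\<^sub>C (r *\<^sub>R ?R x)
          = r *\<^sub>R (op_app T (?R x) - z *\<^sub>C ?R x)"
        by (simp add: scale R(1) scaleR_scaleC complex_vector.scale_right_diff_distrib
            scaleC_scaleC mult.commute)
      then show ?thesis by (simp only: R(2))
    qed
    ultimately show "?R (r *\<^sub>R x) = r *\<^sub>R ?R x"
      using R(3)[of "r *\<^sub>R ?R x"] by simp
  next
    fix x
    have "m * norm (?R x) \<le> norm x"
      using bounded_belowD[OF m(2) R(1)[of x]] by (simp only: R(2))
    then show "norm (?R x) \<le> norm x * inverse m"
      using m(1) by (simp add: field_simps)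
  qed
  with bij show ?thesis
    by (simp add: mem_resolvent_set_iff)
qed

text \<open>
  \<open>(T - w) x = y\<close> is equivalent to \<open>x = (T - z)\<^sup>-\<^sup>1 (y + (w - z) x)\<close>, and the right-hand side is a
  contraction in \<open>x\<close>.
\<close>

lemma bij_perturb:
  fixes T :: "('a::complex_hilbert, 'a) operator"
  assumes z: "z \<in> resolvent_set T" and m: "bounded_below T z m" and zw: "dist z w < m"
  shows "bij_betw (\<lambda>x. op_app T x - w *\<^sub>C x) (op_dom T) UNIV"
proof -
  let ?R = "resolvent T z"
  have bij: "bij_betw (\<lambda>x. op_app T x - z *\<^sub>C x) (op_dom T) UNIV" and bl: "bounded_linear ?R"
    using z by (auto simp: mem_resolvent_set_iff)
  have mpos: "m > 0"
    using zw zero_le_dist[of z w] by linarith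
  have R_le: "norm (?R y) \<le> norm y / m" for y
    using bounded_belowD[OF m resolvent_in_dom[OF bij, of y]] mpos
    by (simp add: resolvent_right[OF bij] field_simps)
  \<comment> \<open>Solutions of the fixed-point equation lie in the domain automatically, as values
    of \<open>?R\<close>. Hence the iteration can run on the whole complete space, although
    \<open>op_dom T\<close> need not be closed.\<close>
  have sol: "x \<in> op_dom T \<and> op_app T x - w *\<^sub>C x = y \<longleftrightarrow> ?R (y + (w - z) *\<^sub>C x) = x" for x y
  proof
    assume x: "x \<in> op_dom T \<and> op_app T x - w *\<^sub>C x = y"
    then have "y + (w - z) *\<^sub>C x = op_app T x - z *\<^sub>C x"
      by (auto simp: complex_vector.scale_left_diff_distrib)
    then show "?R (y + (w - z) *\<^sub>C x) = x"
      using x resolvent_left[OF bij, of x] by simp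
  next
    assume x: "?R (y + (w - z) *\<^sub>C x) = x"
    have "op_app T x - z *\<^sub>C x = y + (w - z) *\<^sub>C x"
      using resolvent_right[OF bij, of "y + (w - z) *\<^sub>C x"] x by simp
    moreover have "x \<in> op_dom T"
      using resolvent_in_dom[OF bij, of "y + (w - z) *\<^sub>C x"] x by simp
    ultimately show "x \<in> op_dom T \<and> op_app T x - w *\<^sub>C x = y"
      by (simp add: complex_vector.scale_left_diff_distrib algebra_simps)
  qed
  have "\<exists>!x. x \<in> op_dom T \<and> op_app T x - w *\<^sub>C x = y" for y
  proof -
    have "\<exists>!x\<in>UNIV. ?R (y + (w - z) *\<^sub>C x) = x"
    \<comment> \<open>The factor is \<open>cmod (w - z)\<close> times the bound \<open>1 / m\<close>
      for \<open>?R\<close>; it is below 1 by \<open>zw\<close>.\<close>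
    proof (rule Banach_fix[OF complete_UNIV, of "dist z w / m"])
      fix u v
      have "dist (?R (y + (w - z) *\<^sub>C u)) (?R (y + (w - z) *\<^sub>C v))
          = norm (?R ((w - z) *\<^sub>C (u - v)))"
        by (simp add: dist_norm complex_vector.scale_right_diff_distrib
            flip: linear_diff[OF bounded_linear.linear[OF bl]])
      also have "\<dots> \<le> norm ((w - z) *\<^sub>C (u - v)) / m"
        by (rule R_le)
      also have "\<dots> = dist z w / m * dist u v"
        by (simp add: norm_scaleC dist_norm norm_minus_commute)
      finally show "dist (?R (y + (w - z) *\<^sub>C u)) (?R (y + (w - z) *\<^sub>C v)) \<le> dist z w / m * dist u v" .
    qed (use mpos zw in auto)
    then show ?thesis
      by (simp add: sol)
  qed
  then show ?thesis
    by (intro bij_betwI') (blast, simp, metis)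
qed

text \<open>Balls about the points of \<open>\<Omega>\<close> inside and outside the resolvent set
  form two open sets covering \<open>\<Omega>\<close>. By perturbation the first stays in the
  resolvent set and the second off it, so connectedness leaves only the first.\<close>

lemma connected_subset_resolvent_set:
  fixes T :: "('a::complex_hilbert, 'a) operator"
  assumes T: "linear_operator T" and conn: "connected \<Omega>"
    and ne: "\<Omega> \<inter> resolvent_set T \<noteq> {}"
    and reg: "\<And>z. z \<in> \<Omega> \<Longrightarrow> \<exists>m>0. bounded_below T z m"
  shows "\<Omega> \<subseteq> resolvent_set T"
proof -
  let ?U = "{w. \<exists>z\<in>\<Omega> \<inter> resolvent_set T. \<exists>m. bounded_below T z m \<and> dist z w < m}"
  \<comment> \<open>Half the radius: for \<open>w\<close> in this set the constant at
    \<open>w\<close> is still \<open>m - dist z w > m / 2\<close>, so if \<open>w\<close> were in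
    the resolvent set, perturbation from \<open>w\<close> would reach back to the centre
    \<open>z\<close>.\<close>
  let ?V = "{w. \<exists>z\<in>\<Omega> - resolvent_set T. \<exists>m. bounded_below T z m \<and> dist z w < m / 2}"
  have "?U = (\<Union>z\<in>\<Omega> \<inter> resolvent_set T. \<Union>m\<in>{m. bounded_below T z m}. ball z m)"
    by (auto simp: ball_def)
  then have U: "open ?U" by auto
  have "?V = (\<Union>z\<in>\<Omega> - resolvent_set T. \<Union>m\<in>{m. bounded_below T z m}. ball z (m / 2))"
    by (auto simp: ball_def)
  then have V: "open ?V" by auto
  have U_sub: "w \<in> resolvent_set T" if "w \<in> ?U" for w
  proof -
    obtain z m where z: "z \<in> resolvent_set T" "bounded_below T z m" "dist z w < m"
      using \<open>w \<in> ?U\<close> by auto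
    show ?thesis
      using resolvent_setI[OF T bij_perturb[OF z] _ bounded_below_perturb[OF z(2)]] z(3) by simp
  qed
  have V_sub: "w \<notin> resolvent_set T" if w: "w \<in> ?V" for w
  proof
    assume wr: "w \<in> resolvent_set T"
    obtain z m where z: "z \<notin> resolvent_set T" "bounded_below T z m" "dist z w < m / 2"
      using \<open>w \<in> ?V\<close> by auto
    have m: "m > 0"
      using z(3) zero_le_dist[of z w] by linarith
    have "dist w z < m - dist z w"
      using z(3) by (simp add: dist_commute)
    then have "z \<in> resolvent_set T"
      using resolvent_setI[OF T bij_perturb[OF wr bounded_below_perturb[OF z(2)]] m z(2)] by simp
    with z(1) show False ..
  qed
  have U_sup: "z \<in> ?U" if "z \<in> \<Omega>" "z \<in> resolvent_set T" for z
    using reg[OF that(1)] that by force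
  have V_sup: "z \<in> ?V" if z: "z \<in> \<Omega>" "z \<notin> resolvent_set T" for z
  proof -
    obtain m where "m > 0" "bounded_below T z m"
      using reg[OF z(1)] by blast
    then have "bounded_below T z m \<and> dist z z < m / 2" by simp
    then show ?thesis using z by blast
  qed
  have "?U \<inter> ?V \<inter> \<Omega> = {}"
    using U_sub V_sub by blast
  moreover have "\<Omega> \<subseteq> ?U \<union> ?V"
    using U_sup V_sup by blast
  ultimately have "?U \<inter> \<Omega> = {} \<or> ?V \<inter> \<Omega> = {}"
    by (intro connectedD[OF conn U V])
  moreover have "?U \<inter> \<Omega> \<noteq> {}"
    using ne U_sup by blast
  ultimately show ?thesis
    using V_sup by blast
qed

lemma onorm_resolvent_le:
  assumes z: "z \<in> resolvent_set T" and m: "m > 0" "bounded_below T z m"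
  shows "onorm (resolvent T z) \<le> 1 / m"
proof (rule onorm_bound)
  have bij: "bij_betw (\<lambda>x. op_app T x - z *\<^sub>C x) (op_dom T) UNIV"
    using z by (simp add: mem_resolvent_set_iff)
  show "norm (resolvent T z y) \<le> 1 / m * norm y" for y
    using bounded_belowD[OF m(2) resolvent_in_dom[OF bij, of y]] m(1)
    by (simp add: resolvent_right[OF bij] field_simps)
qed (use m in simp)


section \<open>The pencils of diagonal multiples\<close>

text \<open>The action of the everywhere defined operator \<open>op_diag a d\<close> as a plain
  function, so that no domains need to be carried along.\<close>

definition diag_map :: "complex \<Rightarrow> complex \<Rightarrow> 'a::complex_vector \<times> 'b::complex_vector \<Rightarrow> 'a \<times> 'b"
  where "diag_map a d v = (a *\<^sub>C fst v, d *\<^sub>C snd v)"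

lemma diag_map_diff: "diag_map a d (u - v) = diag_map a d u - diag_map a d v"
  by (simp add: diag_map_def complex_vector.scale_right_diff_distrib)

lemma diag_map_scaleC: "diag_map a d (c *\<^sub>C v) = c *\<^sub>C diag_map a d v"
  by (simp add: diag_map_def scaleC_prod_def scaleC_scaleC mult.commute)

text \<open>Each component is stretched by at most the maximum; this is the origin of the numerator
  in the resolvent estimate.\<close>

lemma norm_diag_map_le:
  fixes v :: "'a::complex_inner \<times> 'b::complex_inner"
  shows "norm (diag_map a d v) \<le> max (cmod a) (cmod d) * norm v"
proof -
  let ?M = "max (cmod a) (cmod d)"
  have "(norm (diag_map a d v))\<^sup>2 = (cmod a * norm (fst v))\<^sup>2 + (cmod d * norm (snd v))\<^sup>2"
    by (simp add: diag_map_def norm_prod_def norm_scaleC)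
  also have "\<dots> \<le> (?M * norm (fst v))\<^sup>2 + (?M * norm (snd v))\<^sup>2"
    by (intro add_mono power_mono mult_right_mono) auto
  also have "\<dots> = (?M * norm v)\<^sup>2"
    by (simp add: norm_prod_def power_mult_distrib algebra_simps)
  finally show ?thesis
    by (rule power2_le_imp_le) (simp add: le_max_iff_disj)
qed

text \<open>The convex weights are the squared norms of the two components of
  \<open>v\<close>.\<close>

lemma cinner_diag_map_mem_hull:
  fixes v :: "'a::complex_inner \<times> 'b::complex_inner"
  assumes "norm v = 1"
  shows "cinner (diag_map a d v) v \<in> convex hull {a, d}"
proof -
  have "cinner (diag_map a d v) v = (norm (fst v))\<^sup>2 *\<^sub>R a + (norm (snd v))\<^sup>2 *\<^sub>R d"
    by (simp add: diag_map_def cinner_prod_def cinner_scaleC_left cinner_self scaleR_conv_of_real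
        mult.commute)
  moreover have "(norm (fst v))\<^sup>2 + (norm (snd v))\<^sup>2 = 1"
    using assms by (simp add: norm_prod_def)
  ultimately show ?thesis
    unfolding convex_hull_2 by (blast intro: zero_le_power2)
qed

text \<open>By linearity \<open>diag_map a d\<close> factors out of the pencil and leaves
  \<open>T - z\<close>.\<close>

lemma num_range_diag_pencil:
  "num_range (op_minus (op_comp (op_diag a d) T) (op_scale z (op_diag a d)))
    = {cinner (diag_map a d (op_app T v - z *\<^sub>C v)) v |v. v \<in> op_dom T \<and> norm v = 1}"
  by (simp add: num_range_def op_minus_def op_comp_def op_scale_def op_diag_def case_prod_beta
      diag_map_diff diag_map_scaleC flip: diag_map_def)

text \<open>An exact zero of the form, rather than a limit of values, serves both the quadratic
  numerical range and the quotient \<open>\<mu>\<close> of the resolvent estimate.\<close>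

lemma mem_diag_pencil_rangeI:
  assumes "v \<in> op_dom T" "norm v = 1" "cinner (diag_map a d (op_app T v - z *\<^sub>C v)) v = 0"
  shows "z \<in> pencil_range (op_comp (op_diag a d) T) (op_diag a d)"
  unfolding pencil_range_def mem_Collect_eq num_range_diag_pencil
  by (rule closure_subset[THEN subsetD], rule CollectI, rule exI[of _ v]) (simp add: assms)

lemma cmod_cinner_diag_map_le:
  assumes "norm v = 1"
  shows "cmod (cinner (diag_map a d u) v) \<le> max (cmod a) (cmod d) * norm u"
  using Cauchy_Schwarz_cinner[of "diag_map a d u" v] norm_diag_map_le[of a d u] assms by simp

text \<open>The numerical range stays at a distance \<open>e\<close> from 0, and Cauchy-Schwarz
  passes this on to \<open>T - z\<close>. Pairs with 0 in \<open>convex hull {a, d}\<close> are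
  included, for which the quantitative estimate says nothing.\<close>

lemma bounded_below_outside_pencil_range:
  assumes T: "linear_operator T"
    and z: "z \<notin> pencil_range (op_comp (op_diag a d) T) (op_diag a d)"
  shows "\<exists>m>0. bounded_below T z m"
proof -
  let ?M = "max (cmod a) (cmod d)"
  have M: "0 \<le> ?M" by (simp add: le_max_iff_disj)
  obtain e where e: "e > 0"
    "\<And>v. v \<in> op_dom T \<Longrightarrow> norm v = 1 \<Longrightarrow> e \<le> cmod (cinner (diag_map a d (op_app T v - z *\<^sub>C v)) v)"
  proof -
    obtain e where e: "e > 0"
      "\<not> (\<exists>y\<in>{cinner (diag_map a d (op_app T v - z *\<^sub>C v)) v |v. v \<in> op_dom T \<and> norm v = 1}. dist y 0 < e)"
      using z unfolding pencil_range_def mem_Collect_eq num_range_diag_pencil closure_approachable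
      by blast
    show thesis
    proof (rule that[OF e(1)])
      fix v assume "v \<in> op_dom T" "norm v = 1"
      then have "\<not> dist (cinner (diag_map a d (op_app T v - z *\<^sub>C v)) v) 0 < e"
        using e(2) by blast
      then show "e \<le> cmod (cinner (diag_map a d (op_app T v - z *\<^sub>C v)) v)"
        by simp
    qed
  qed
  \<comment> \<open>Adding 1 keeps the denominator positive also for
    \<open>a = d = 0\<close>.\<close>
  have "bounded_below T z (e / (?M + 1))"
  proof (rule bounded_below_if_unit[OF T])
    fix v assume v: "v \<in> op_dom T" "norm v = 1"
    have "e \<le> ?M * norm (op_app T v - z *\<^sub>C v)"
      using e(2)[OF v] cmod_cinner_diag_map_le[OF v(2)] by (rule order_trans)
    also have "\<dots> \<le> (?M + 1) * norm (op_app T v - z *\<^sub>C v)"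
      by (rule mult_right_mono) auto
    finally show "e / (?M + 1) \<le> norm (op_app T v - z *\<^sub>C v)"
      using M by (simp add: field_simps)
  qed
  then show ?thesis
    using e(1) M by (intro exI[of _ "e / (?M + 1)"]) auto
qed

text \<open>Real lower bounds \<open>p\<close> and \<open>q\<close> stand in for the two distances.
  For an empty pencil range every \<open>q \<ge> 0\<close> is admissible, which later yields the
  case of infinite distance.\<close>

lemma bounded_below_dist_pencil_range:
  assumes T: "linear_operator T"
    and p: "0 < p" "\<And>w. w \<in> convex hull {a, d} \<Longrightarrow> p \<le> cmod w"
    and q: "0 \<le> q" "\<And>w. w \<in> pencil_range (op_comp (op_diag a d) T) (op_diag a d) \<Longrightarrow> q \<le> dist z w"
  shows "bounded_below T z (p * q / max (cmod a) (cmod d))"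
proof (rule bounded_below_if_unit[OF T])
  fix v assume v: "v \<in> op_dom T" "norm v = 1"
  have "p \<le> cmod a"
    by (rule p(2)) (simp add: hull_inc)
  then have M: "max (cmod a) (cmod d) > 0"
    using p(1) by linarith
  define s where "s = cinner (diag_map a d v) v"
  \<comment> \<open>The root of the affine function sending \<open>w\<close> to the form of
    \<open>T - w\<close> at \<open>v\<close>; its slope \<open>- s\<close> is nonzero because the
    hull avoids 0.\<close>
  define \<mu> where "\<mu> = cinner (diag_map a d (op_app T v)) v / s"
  have s: "p \<le> cmod s"
    unfolding s_def using p(2) cinner_diag_map_mem_hull[OF v(2)] by blast
  then have s0: "s \<noteq> 0" using p(1) by auto
  have form: "cinner (diag_map a d (op_app T v - w *\<^sub>C v)) v = (\<mu> - w) * s" for w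
    using s0 by (simp add: diag_map_diff diag_map_scaleC cinner_diff_left cinner_scaleC_left
        \<mu>_def left_diff_distrib flip: s_def)
  have "\<mu> \<in> pencil_range (op_comp (op_diag a d) T) (op_diag a d)"
    by (rule mem_diag_pencil_rangeI[OF v]) (simp add: form)
  then have "p * q \<le> cmod s * dist z \<mu>"
    using s p(1) q by (intro mult_mono) auto
  also have "\<dots> = cmod (cinner (diag_map a d (op_app T v - z *\<^sub>C v)) v)"
    by (simp add: form norm_mult dist_norm norm_minus_commute)
  also have "\<dots> \<le> max (cmod a) (cmod d) * norm (op_app T v - z *\<^sub>C v)"
    by (rule cmod_cinner_diag_map_le[OF v(2)])
  finally show "p * q / max (cmod a) (cmod d) \<le> norm (op_app T v - z *\<^sub>C v)"
    using M by (simp add: field_simps)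
qed

section \<open>Passage to extended-valued distances\<close>

lemma set_dist_le: "w \<in> M \<Longrightarrow> set_dist z M \<le> ereal (dist z w)"
  unfolding set_dist_def by (rule INF_lower)

lemma set_dist_nonneg: "0 \<le> set_dist z M"
  unfolding set_dist_def by (rule INF_greatest) simp

lemma onorm_resolvent_le_pencil:
  fixes T :: "('a::complex_hilbert \<times> 'b::complex_hilbert, 'a \<times> 'b) operator"
  assumes T: "linear_operator T" and z: "z \<in> resolvent_set T"
  shows "ereal (onorm (resolvent T z)) \<le>
    ext_quot (ereal (max (cmod a) (cmod d)))
      (set_dist 0 (convex hull {a, d}) *
       set_dist z (pencil_range (op_comp (op_diag a d) T) (op_diag a d)))"
proof -
  let ?W = "pencil_range (op_comp (op_diag a d) T) (op_diag a d)"
  let ?M = "max (cmod a) (cmod d)"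
  \<comment> \<open>The hull contains \<open>a\<close>, so this distance is finite; only the
    distance to the pencil range can be infinite.\<close>
  have "set_dist 0 (convex hull {a, d}) \<le> ereal (dist 0 a)"
    by (rule set_dist_le) (simp add: hull_inc)
  then obtain p where p: "set_dist 0 (convex hull {a, d}) = ereal p" "0 \<le> p" "p \<le> cmod a"
    using set_dist_nonneg[of 0 "convex hull {a, d}"]
    by (cases "set_dist 0 (convex hull {a, d})") auto
  have p_le: "p \<le> cmod w" if "w \<in> convex hull {a, d}" for w
    using set_dist_le[OF that, of 0] p(1) by simp
  show ?thesis
  proof (cases "p = 0 \<or> set_dist z ?W = 0")
    \<comment> \<open>In \<open>ereal\<close> zero times infinity is 0, so \<open>p = 0\<close>
      makes the denominator vanish even for an empty pencil range.\<close>
    case True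
    then have "set_dist 0 (convex hull {a, d}) * set_dist z ?W = 0"
      by (auto simp: p(1))
    then show ?thesis
      by (simp add: ext_quot_def)
  next
    case False
    then have pp: "0 < p" using p(2) by simp
    then have M: "0 < ?M" using p(3) by linarith
    \<comment> \<open>A finite distance is itself a valid \<open>q\<close>; an infinite one is
      exploited through arbitrarily large \<open>q\<close>.\<close>
    have bound: "onorm (resolvent T z) \<le> ?M / (p * q)"
      if q: "0 < q" "ereal q \<le> set_dist z ?W" for q
    proof -
      have "q \<le> dist z w" if "w \<in> ?W" for w
        using order_trans[OF q(2) set_dist_le[OF that]] by simp
      then have "bounded_below T z (p * q / ?M)"
        using pp p_le q(1) by (intro bounded_below_dist_pencil_range[OF T]) auto
      then have "onorm (resolvent T z) \<le> 1 / (p * q / ?M)"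
        using pp q(1) M by (intro onorm_resolvent_le[OF z]) auto
      then show ?thesis by simp
    qed
    show ?thesis
    proof (cases "set_dist z ?W")
      case (real q)
      have "0 < q"
        using False real set_dist_nonneg[of z ?W] by auto
      then show ?thesis
        using bound[of q] real pp by (simp add: ext_quot_def p(1) flip: ereal_max)
    next
      case PInf
      text \<open>Then \<open>?W\<close> is empty, and the quotient vanishes.\<close>
      have "onorm (resolvent T z) \<le> 0"
      proof (rule field_le_epsilon)
        \<comment> \<open>The choice \<open>q = ?M / (p * e)\<close> makes
          \<open>?M / (p * q)\<close> equal to \<open>e\<close>.\<close>
        fix e :: real assume "0 < e"
        then show "onorm (resolvent T z) \<le> 0 + e"
          using bound[of "?M / (p * e)"] PInf pp M by simp
      qed
      then show ?thesis
        using PInf pp by (simp add: ext_quot_def p(1))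
    next
      case MInf
      then show ?thesis using set_dist_nonneg[of z ?W] by simp
    qed
  qed
qed


section \<open>Block operator matrices\<close>

lemma linear_operator_block_op:
  assumes "linear_operator A" "linear_operator B" "linear_operator C" "linear_operator D"
  shows "linear_operator (block_op A B C D)"
  using assms
  unfolding linear_operator_def block_op_def complex_vector.subspace_def
  by (simp add: scaleC_prod_def scaleC_add_right zero_prod_def Ball_def split_paired_All)

text \<open>An eigenvector with entries \<open>s\<close>, \<open>t\<close> lifts to the vector with
  components \<open>s *\<^sub>C x\<close>, \<open>t *\<^sub>C y\<close>. Testing
  \<open>T - z\<close> on it reproduces the two rows of the eigenvalue equation, so the form
  vanishes whatever weights \<open>a\<close> and \<open>d\<close> the rows carry.\<close>

lemma quadratic_num_range_subset_pencil_range: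
  assumes lin: "linear_operator A" "linear_operator B" "linear_operator C" "linear_operator D"
  shows "quadratic_num_range A B C D
    \<subseteq> pencil_range (op_comp (op_diag a d) (block_op A B C D)) (op_diag a d)"
proof
  fix z assume "z \<in> quadratic_num_range A B C D"
  then obtain x y where dom: "x \<in> op_dom A" "x \<in> op_dom C" "y \<in> op_dom B" "y \<in> op_dom D"
    and xy: "norm x = 1" "norm y = 1"
    and ev: "eigenvalue (block_mat A B C D x y) z"
    by (auto simp: quadratic_num_range_def block_op_def spectrum_def)
  let ?P = "block_mat A B C D x y"
  have P: "?P \<in> carrier_mat 2 2"
    by (simp add: block_mat_def mat_of_rows_list_def numeral_2_eq_2)
  from ev P obtain u where u: "u \<in> carrier_vec 2" "u \<noteq> 0\<^sub>v 2" "?P *\<^sub>v u = z \<cdot>\<^sub>v u"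
    by (auto simp: eigenvalue_def eigenvector_def)
  define s where "s = vec_index u 0"
  define t where "t = vec_index u 1"
  have st: "s \<noteq> 0 \<or> t \<noteq> 0"
  proof (rule ccontr)
    assume "\<not> ?thesis"
    then have "u = 0\<^sub>v 2"
      using u(1) by (intro eq_vecI) (auto simp: s_def t_def less_2_cases_iff)
    with u(2) show False ..
  qed
  have row: "vec_index (?P *\<^sub>v u) i = ?P $$ (i, 0) * s + ?P $$ (i, 1) * t" if "i < 2" for i
    using that P u(1) by (simp add: scalar_prod_def s_def t_def numeral_2_eq_2)
  have eq1: "cinner (op_app A x) x * s + cinner (op_app B y) x * t = z * s"
    using row[of 0] u(1) by (simp add: u(3) s_def) (simp add: block_mat_def mat_of_rows_list_def)
  have eq2: "cinner (op_app C x) y * s + cinner (op_app D y) y * t = z * t"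
    using row[of 1] u(1) by (simp add: u(3) t_def) (simp add: block_mat_def mat_of_rows_list_def)
  \<comment> \<open>Since \<open>x\<close> and \<open>y\<close> are unit vectors, this is the norm
    of the lifted vector.\<close>
  define r where "r = sqrt ((cmod s)\<^sup>2 + (cmod t)\<^sup>2)"
  have r: "r > 0"
    using st by (auto simp: r_def sum_power2_gt_zero_iff)
  define v where "v = (complex_of_real (inverse r)) *\<^sub>C (s *\<^sub>C x, t *\<^sub>C y)"
  show "z \<in> pencil_range (op_comp (op_diag a d) (block_op A B C D)) (op_diag a d)"
  proof (rule mem_diag_pencil_rangeI)
    show "norm v = 1"
      using r by (simp add: v_def norm_scaleC norm_Pair xy norm_inverse flip: r_def)
    let ?w = "(s *\<^sub>C x, t *\<^sub>C y)"
    have lT: "linear_operator (block_op A B C D)"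
      by (rule linear_operator_block_op[OF lin])
    have w: "?w \<in> op_dom (block_op A B C D)"
      using lin dom by (auto simp: block_op_def linear_operator_def complex_vector.subspace_scale)
    show "v \<in> op_dom (block_op A B C D)"
      using lT w unfolding v_def linear_operator_def by (blast intro: complex_vector.subspace_scale)
    have Tv: "op_app (block_op A B C D) v
        = complex_of_real (inverse r) *\<^sub>C op_app (block_op A B C D) ?w"
      using lT w unfolding v_def linear_operator_def by blast
    have Tw: "op_app (block_op A B C D) ?w
        = (s *\<^sub>C op_app A x + t *\<^sub>C op_app B y, s *\<^sub>C op_app C x + t *\<^sub>C op_app D y)"
      using lin dom by (simp add: block_op_def linear_operator_def)
    \<comment> \<open>The brackets are the residuals of \<open>eq1\<close> and
      \<open>eq2\<close>.\<close>
    have "cinner (diag_map a d (op_app (block_op A B C D) ?w - z *\<^sub>C ?w)) ?w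
        = a * cnj s * (cinner (op_app A x) x * s + cinner (op_app B y) x * t - z * s)
          + d * cnj t * (cinner (op_app C x) y * s + cinner (op_app D y) y * t - z * t)"
      by (simp add: Tw diag_map_def scaleC_prod_def cinner_prod_def cinner_scaleC_left
          cinner_scaleC_right cinner_add_left cinner_diff_left cinner_self xy algebra_simps)
    also have "\<dots> = 0"
      by (simp add: eq1 eq2)
    finally have w0: "cinner (diag_map a d (op_app (block_op A B C D) ?w - z *\<^sub>C ?w)) ?w = 0" .
    have "op_app (block_op A B C D) v - z *\<^sub>C v
        = complex_of_real (inverse r) *\<^sub>C (op_app (block_op A B C D) ?w - z *\<^sub>C ?w)"
      unfolding Tv complex_vector.scale_right_diff_distrib
      by (simp only: v_def scaleC_scaleC mult.commute)
    then show "cinner (diag_map a d (op_app (block_op A B C D) v - z *\<^sub>C v)) v = 0"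
      by (simp only: diag_map_scaleC v_def cinner_scaleC_left cinner_scaleC_right w0 mult_zero_right)
  qed
qed

theorem theorem4p8:
  fixes A :: "('a::complex_hilbert, 'a) operator"
    and B :: "('b::complex_hilbert, 'a) operator"
    and C :: "('a, 'b) operator"
    and D :: "('b, 'b) operator"
  assumes "linear_operator A" and "linear_operator B"
    and "linear_operator C" and "linear_operator D"
  shows
    "quadratic_num_range A B C D
        \<subseteq> (\<Inter>a. \<Inter>d. pencil_range (op_comp (op_diag a d) (block_op A B C D)) (op_diag a d)) \<and>
     (\<forall>(\<Lambda> :: (complex \<times> complex) set) (\<Omega> :: complex set).
        \<Omega> \<subseteq> UNIV - (\<Inter>(a, d)\<in>\<Lambda>.
               pencil_range (op_comp (op_diag a d) (block_op A B C D)) (op_diag a d)) \<longrightarrow>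
        connected \<Omega> \<longrightarrow>
        \<Omega> \<inter> resolvent_set (block_op A B C D) \<noteq> {} \<longrightarrow>
        \<Omega> \<subseteq> resolvent_set (block_op A B C D) \<and>
        (\<forall>z\<in>\<Omega>.
           ereal (onorm (resolvent (block_op A B C D) z)) \<le>
           (INF (a, d)\<in>\<Lambda>.
              ext_quot (ereal (max (cmod a) (cmod d)))
                (set_dist 0 (convex hull {a, d}) *
                 set_dist z (pencil_range (op_comp (op_diag a d) (block_op A B C D))
                                (op_diag a d))))))"
proof (intro conjI allI impI ballI)
  show "quadratic_num_range A B C D
      \<subseteq> (\<Inter>a. \<Inter>d. pencil_range (op_comp (op_diag a d) (block_op A B C D)) (op_diag a d))"
    using quadratic_num_range_subset_pencil_range[OF assms] by blast
next
  let ?T = "block_op A B C D"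
  have T: "linear_operator ?T"
    by (rule linear_operator_block_op[OF assms])
  fix \<Lambda> :: "(complex \<times> complex) set" and \<Omega> :: "complex set"
  assume \<Omega>: "\<Omega> \<subseteq> UNIV - (\<Inter>(a, d)\<in>\<Lambda>. pencil_range (op_comp (op_diag a d) ?T) (op_diag a d))"
    and conn: "connected \<Omega>" and ne: "\<Omega> \<inter> resolvent_set ?T \<noteq> {}"
  \<comment> \<open>Lying outside the intersection gives one good pair for each \<open>z\<close>,
    possibly a different one each time; the connectedness argument asks only for regular
    type.\<close>
  have "\<exists>m>0. bounded_below ?T z m" if z: "z \<in> \<Omega>" for z
  proof -
    obtain a d where "z \<notin> pencil_range (op_comp (op_diag a d) ?T) (op_diag a d)"
      using subsetD[OF \<Omega> z] by blast
    then show ?thesis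
      by (rule bounded_below_outside_pencil_range[OF T])
  qed
  then show sub: "\<Omega> \<subseteq> resolvent_set ?T"
    by (rule connected_subset_resolvent_set[OF T conn ne])
  fix z assume "z \<in> \<Omega>"
  then have "z \<in> resolvent_set ?T"
    using sub by blast
  \<comment> \<open>Here all pairs of \<open>\<Lambda>\<close> enter; those whose pencil range
    contains \<open>z\<close> contribute infinity.\<close>
  then show "ereal (onorm (resolvent ?T z)) \<le>
      (INF (a, d)\<in>\<Lambda>. ext_quot (ereal (max (cmod a) (cmod d)))
        (set_dist 0 (convex hull {a, d}) *
         set_dist z (pencil_range (op_comp (op_diag a d) ?T) (op_diag a d))))"
    using onorm_resolvent_le_pencil[OF T] by (intro INF_greatest) (simp only: split_beta)
qed

end
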